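(* Let $t=3^s-1$ for some integer $s\ge 2$. Then $$\mathrm{ex}^*(n,B_{t,3}) \ge \frac{t}{2}n + O(1).$$
   Context: All graphs are finite and simple. An edge-coloring of a graph is a function $c:E(G)\to\mathbb{N}$; it is proper if incident edges receive different colors. A subgraph is rainbow under $c$ if its edges have pairwise distinct colors. A graph $G$ is rainbow-$F$-free if it admits a proper edge-coloring under which no (not necessarily induced) copy of $F$ in $G$ is rainbow. The rainbow Turán number $\mathrm{ex}^*(n,F)$ is the maximum number of edges in an $n$-vertex rainbow-$F$-free graph. For $t\ge 3$, $B_{t,3}$ is the broom with $t$ edges and handle length $3$: the tree obtained from a path with $3$ edges (the handle) by adding $t-3$ pendant edges (the bristles) at one end vertex of the path. Here $O(1)$ is a quantity bounded in absolute value by a constant depending only on $t$, as $n\to\infty$. *)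

theory Defs
  imports Complex_Main "HOL-Library.Landau_Symbols"
begin

text \<open>A graph is a pair of a vertex set and a set of edges, an edge being a set of two vertices.\<close>

type_synonym 'a graph = "'a set \<times> 'a set set"

abbreviation verts :: "'a graph \<Rightarrow> 'a set" where "verts \<equiv> fst"
abbreviation edges :: "'a graph \<Rightarrow> 'a set set" where "edges \<equiv> snd"

definition finite_simple_graph :: "'a graph \<Rightarrow> bool" where
  "finite_simple_graph G \<longleftrightarrow>
     finite (verts G) \<and> (\<forall>e \<in> edges G. e \<subseteq> verts G \<and> card e = 2)"

definition subgraph :: "'a graph \<Rightarrow> 'a graph \<Rightarrow> bool" where
  "subgraph H G \<longleftrightarrow>
     finite_simple_graph H \<and> verts H \<subseteq> verts G \<and> edges H \<subseteq> edges G"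

definition isomorphic :: "'a graph \<Rightarrow> 'b graph \<Rightarrow> bool" where
  "isomorphic F H \<longleftrightarrow>
     (\<exists>f. bij_betw f (verts F) (verts H) \<and> (\<lambda>e. f ` e) ` edges F = edges H)"

definition copy_of_in :: "'b graph \<Rightarrow> 'a graph \<Rightarrow> 'a graph \<Rightarrow> bool" where
  "copy_of_in F H G \<longleftrightarrow> subgraph H G \<and> isomorphic F H"

text \<open>Colorings are total functions; only their values on the edges of the graph are ever used.\<close>

definition proper_edge_coloring :: "'a graph \<Rightarrow> ('a set \<Rightarrow> nat) \<Rightarrow> bool" where
  "proper_edge_coloring G c \<longleftrightarrow>
     (\<forall>e \<in> edges G. \<forall>e' \<in> edges G. e \<noteq> e' \<and> e \<inter> e' \<noteq> {} \<longrightarrow> c e \<noteq> c e')"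

definition rainbow :: "('a set \<Rightarrow> nat) \<Rightarrow> 'a graph \<Rightarrow> bool" where
  "rainbow c H \<longleftrightarrow> inj_on c (edges H)"

definition rainbow_free :: "'b graph \<Rightarrow> 'a graph \<Rightarrow> bool" where
  "rainbow_free F G \<longleftrightarrow>
     (\<exists>c. proper_edge_coloring G c \<and> \<not> (\<exists>H. copy_of_in F H G \<and> rainbow c H))"

text \<open>Up to isomorphism, every finite graph has its vertices in \<^typ>\<open>nat\<close>. The maximum is over a
  finite set, which is nonempty as soon as \<open>F\<close> has an edge; see the two lemmas that follow.\<close>

definition rainbow_turan :: "nat \<Rightarrow> 'b graph \<Rightarrow> nat" where
  "rainbow_turan n F =
     Max {card (edges G) | G :: nat graph.
            finite_simple_graph G \<and> card (verts G) = n \<and> rainbow_free F G}"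

lemma rainbow_turan_finite:
  "finite {card (edges G) | G :: nat graph.
            finite_simple_graph G \<and> card (verts G) = n \<and> rainbow_free F G}"
proof (rule finite_subset)
  have "card (edges G) \<le> 2 ^ card (verts G)" if "finite_simple_graph G" for G :: "nat graph"
  proof -
    have "edges G \<subseteq> Pow (verts G)" "finite (verts G)"
      using that by (auto simp: finite_simple_graph_def)
    then show ?thesis
      using card_mono[of "Pow (verts G)" "edges G"] by (simp add: card_Pow)
  qed
  then show "{card (edges G) | G :: nat graph.
            finite_simple_graph G \<and> card (verts G) = n \<and> rainbow_free F G} \<subseteq> {..2 ^ n}"
    by auto
qed simp

lemma rainbow_turan_nonempty:
  assumes "edges F \<noteq> {}"
  shows "{card (edges G) | G :: nat graph.
            finite_simple_graph G \<and> card (verts G) = n \<and> rainbow_free F G} \<noteq> {}"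
proof -
  let ?G = "({..<n}, {}) :: nat graph"
  have "\<not> copy_of_in F H ?G" for H
    using assms by (auto simp: copy_of_in_def subgraph_def isomorphic_def)
  then have "rainbow_free F ?G"
    by (simp add: rainbow_free_def proper_edge_coloring_def)
  moreover have "finite_simple_graph ?G"
    by (simp add: finite_simple_graph_def)
  moreover have "card (verts ?G) = n"
    by simp
  ultimately show ?thesis
    by blast
qed

text \<open>The broom with \<open>t\<close> edges and handle length \<open>l\<close>: the handle is the path \<open>0, 1, \<dots>, l\<close>, and the
  bristles join its end vertex \<open>l\<close> to the leaves \<open>l + 1, \<dots>, t\<close>. Meant for \<open>l \<le> t\<close>.\<close>

definition broom :: "nat \<Rightarrow> nat \<Rightarrow> nat graph" where
  "broom t l = ({0..t}, {{i, i + 1} | i. i < l} \<union> {{l, j} | j. l < j \<and> j \<le> t})"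

lemma finite_simple_graph_broom: "l \<le> t \<Longrightarrow> finite_simple_graph (broom t l)"
  by (auto simp: finite_simple_graph_def broom_def)

lemma card_edges_broom:
  assumes "l \<le> t"
  shows "card (edges (broom t l)) = t"
proof -
  have 1: "{{i, i + 1} | i. i < l} = (\<lambda>i. {i, i + 1}) ` {..<l}"
    and 2: "{{l, j} | j. l < j \<and> j \<le> t} = (\<lambda>j. {l, j}) ` {l<..t}" by auto
  have "card ((\<lambda>i. {i, i + 1}) ` {..<l}) = l" "card ((\<lambda>j. {l, j}) ` {l<..t}) = t - l"
    by (subst card_image; force simp: inj_on_def doubleton_eq_iff)+
  moreover have "(\<lambda>i. {i, i + 1}) ` {..<l} \<inter> (\<lambda>j. {l, j}) ` {l<..t} = {}"
    by (auto simp: doubleton_eq_iff)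
  ultimately show ?thesis
    using assms unfolding broom_def snd_conv 1 2 by (subst card_Un_disjoint) auto
qed

end

theory Submission imports Defs
begin

text \<open>Identify the vertices of \<open>K\<^sub>N\<close>, \<open>N = 3\<^sup>s\<close>, with \<open>\<F>\<^sub>3\<^sup>s\<close> and color the edge \<open>xy\<close>
  with \<open>x \<cdot> y = - x - y\<close>. This is the idempotent commutative operation of a Steiner triple system:
  \<open>x \<cdot> (x \<cdot> y) = y\<close>. At every vertex \<open>x\<close> exactly one of the \<open>N\<close> colors is missing, namely \<open>x\<close>.
  A rainbow broom \<open>B\<^bsub>N-1,3\<^esub>\<close> with handle \<open>v\<^sub>0 v\<^sub>1 v\<^sub>2 v\<^sub>3\<close> would span \<open>K\<^sub>N\<close>, so the edges
  \<open>v\<^sub>0 v\<^sub>1\<close> and \<open>v\<^sub>1 v\<^sub>2\<close> could only have the colors \<open>v\<^sub>3\<close>, \<open>v\<^sub>3 \<cdot> v\<^sub>0\<close> and \<open>v\<^sub>3 \<cdot> v\<^sub>1\<close>. This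
  forces \<open>v\<^sub>0 \<cdot> v\<^sub>1 = v\<^sub>3\<close>, after which no color is left for \<open>v\<^sub>1 v\<^sub>2\<close>. Disjoint copies of \<open>K\<^sub>N\<close> give
  the bound.\<close>

text \<open>The elements are the numbers below \<open>N\<close>, so that they can serve both as
  vertex labels and as colors.\<close>

definition steiner_quasigroup :: "nat \<Rightarrow> (nat \<Rightarrow> nat \<Rightarrow> nat) \<Rightarrow> bool" where
  "steiner_quasigroup N m \<longleftrightarrow>
     (\<forall>x<N. m x x = x) \<and>
     (\<forall>x<N. \<forall>y<N. m x y < N \<and> m x y = m y x \<and> m x (m x y) = y)"

text \<open>Digitwise \<open>- x - y\<close> modulo 3 on the last \<open>s\<close> ternary digits.\<close>

fun ternary_op :: "nat \<Rightarrow> nat \<Rightarrow> nat \<Rightarrow> nat" where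
  "ternary_op 0 x y = 0"
| "ternary_op (Suc s) x y = 3 * ternary_op s (x div 3) (y div 3) + 2 * (x + y) mod 3"

text \<open>Induction peels off the last ternary digit; since 2 = -1 modulo 3,
  \<open>2 * (x + y) mod 3\<close> is that digit of -x - y.\<close>

lemma steiner_quasigroup_ternary_op: "steiner_quasigroup (3 ^ s) (ternary_op s)"
proof (induction s)
  case 0
  show ?case by (simp add: steiner_quasigroup_def)
next
  case (Suc s)
  have less: "x div 3 < 3 ^ s" if "x < 3 ^ Suc s" for x :: nat
    using that by (simp add: less_mult_imp_div_less mult.commute)
  have idem: "ternary_op (Suc s) x x = x" if "x < 3 ^ Suc s" for x
  proof -
    have "2 * (x + x) mod 3 = x mod 3" by presburger
    then show ?thesis
      using Suc less[OF that] by (simp add: steiner_quasigroup_def)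
  qed
  moreover have "ternary_op (Suc s) x y < 3 ^ Suc s \<and> ternary_op (Suc s) x y = ternary_op (Suc s) y x
      \<and> ternary_op (Suc s) x (ternary_op (Suc s) x y) = y"
    if "x < 3 ^ Suc s" "y < 3 ^ Suc s" for x y
  proof -
    let ?z = "ternary_op s (x div 3) (y div 3)" and ?r = "2 * (x + y) mod 3"
    have IH: "?z < 3 ^ s" "?z = ternary_op s (y div 3) (x div 3)" "ternary_op s (x div 3) ?z = y div 3"
      using Suc less[OF that(1)] less[OF that(2)] by (auto simp: steiner_quasigroup_def)
    have r: "?r < 3" by simp
    have "3 * ?z + ?r < 3 * 3 ^ s" using IH(1) r by linarith
    moreover have "(3 * ?z + ?r) div 3 = ?z" by simp
    moreover have "2 * (x + (3 * ?z + ?r)) mod 3 = y mod 3"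
    proof -
      \<comment> \<open>Modulo 3, the last digit after two applications is 2x + 4(x + y) = 6x + 4y,
        that is, y.\<close>
      have "2 * (x + (3 * ?z + ?r)) = 2 * ?r + (2 * x + 6 * ?z)" by simp
      also have "\<dots> mod 3 = (2 * (2 * (x + y)) + (2 * x + 6 * ?z)) mod 3"
        by (intro mod_add_cong mod_mult_cong) simp_all
      also have "2 * (2 * (x + y)) + (2 * x + 6 * ?z) = y + 3 * (2 * x + 2 * ?z + y)" by simp
      also have "\<dots> mod 3 = y mod 3" by (rule mod_mult_self2)
      finally show ?thesis .
    qed
    ultimately show ?thesis
      using IH by (simp add: add.commute)
  qed
  ultimately show ?case
    unfolding steiner_quasigroup_def by blast
qed

text \<open>A clique vertex \<open>x\<close> lies in clique \<open>x div N\<close> and has label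
  \<open>x mod N\<close>. Vertices from \<open>q * N\<close> on are isolated.\<close>

definition disjoint_cliques :: "nat \<Rightarrow> nat \<Rightarrow> nat \<Rightarrow> nat graph" where
  "disjoint_cliques N q n = ({..<n}, \<Union>b<q. {e. e \<subseteq> {b * N..<b * N + N} \<and> card e = 2})"

text \<open>\<open>Min\<close> and \<open>Max\<close> merely pick out the two ends of an edge;
  commutativity of the operation makes their order irrelevant.\<close>

definition clique_coloring :: "nat \<Rightarrow> (nat \<Rightarrow> nat \<Rightarrow> nat) \<Rightarrow> nat set \<Rightarrow> nat" where
  "clique_coloring N m e = m (Min e mod N) (Max e mod N)"

lemma finite_simple_graph_disjoint_cliques:
  assumes "q * N \<le> n"
  shows "finite_simple_graph (disjoint_cliques N q n)"
proof -
  have "b * N + N \<le> n" if "b < q" for b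
    using assms that mult_le_mono1[of "Suc b" q N] by simp
  then show ?thesis
    by (fastforce simp: finite_simple_graph_def disjoint_cliques_def)
qed

lemma card_edges_disjoint_cliques: "card (edges (disjoint_cliques N q n)) = q * (N choose 2)"
proof -
  let ?E = "\<lambda>b. {e. e \<subseteq> {b * N..<b * N + N} \<and> card e = 2}"
  have div: "x div N = b" if "x \<in> {b * N..<b * N + N}" for x b
    using that by (intro div_nat_eqI) (auto simp: algebra_simps)
  have "?E b \<inter> ?E b' = {}" if "b \<noteq> b'" for b b'
  proof -
    have "{b * N..<b * N + N} \<inter> {b' * N..<b' * N + N} = {}"
      using div that by blast
    then have "e = {}" if "e \<in> ?E b \<inter> ?E b'" for e using that by blast
    moreover have "card e = 2" if "e \<in> ?E b" for e using that by simp
    ultimately show ?thesis by (metis (lifting) IntD1 card.empty equals0I zero_neq_numeral)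
  qed
  moreover have "finite (?E b)" for b
    by (rule finite_subset[of _ "Pow {b * N..<b * N + N}"]) auto
  ultimately have "card (\<Union>b<q. ?E b) = (\<Sum>b<q. card (?E b))"
    by (intro card_UN_disjoint) auto
  then show ?thesis
    by (simp add: disjoint_cliques_def n_subsets)
qed

lemma edge_disjoint_cliquesD:
  assumes "{x, y} \<in> edges (disjoint_cliques N q n)"
  shows "x \<noteq> y" "x div N = y div N"
proof -
  obtain b where b: "x \<in> {b * N..<b * N + N}" "y \<in> {b * N..<b * N + N}" and "card {x, y} = 2"
    using assms by (auto simp: disjoint_cliques_def)
  then show "x \<noteq> y" by auto
  have "z div N = b" if "z \<in> {b * N..<b * N + N}" for z
    using that by (intro div_nat_eqI) (auto simp: algebra_simps)
  then show "x div N = y div N" using b by simp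
qed

lemma clique_coloring_edge:
  assumes "steiner_quasigroup N m" "N > 0"
  shows "clique_coloring N m {x, y} = m (x mod N) (y mod N)"
proof -
  have "m (x mod N) (y mod N) = m (y mod N) (x mod N)"
    using assms by (simp add: steiner_quasigroup_def)
  then show ?thesis
    by (cases "x \<le> y") (simp_all add: clique_coloring_def min_def max_def)
qed

lemma proper_clique_coloring:
  assumes sq: "steiner_quasigroup N m" and "N > 0"
  shows "proper_edge_coloring (disjoint_cliques N q n) (clique_coloring N m)"
  unfolding proper_edge_coloring_def
proof (intro ballI impI notI)
  let ?G = "disjoint_cliques N q n"
  fix e e'
  assume e: "e \<in> edges ?G" "e' \<in> edges ?G" and ne: "e \<noteq> e' \<and> e \<inter> e' \<noteq> {}"
    and col: "clique_coloring N m e = clique_coloring N m e'"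
  obtain x where x: "x \<in> e" "x \<in> e'" using ne by blast
  have card: "card e = 2" "card e' = 2" using e by (auto simp: disjoint_cliques_def)
  obtain y y' where y: "e = {x, y}" "e' = {x, y'}"
    using x card unfolding card_2_iff by blast
  let ?c = "\<lambda>z. m (x mod N) (z mod N)"
  have "?c y = ?c y'"
    using col clique_coloring_edge[OF assms] y by simp
  \<comment> \<open>Applying the operation with the label of \<open>x\<close> once more recovers the
    label of the other end; the quotient is shared with \<open>x\<close>.\<close>
  then have "m (x mod N) (?c y) = m (x mod N) (?c y')" by simp
  then have "y mod N = y' mod N"
    using sq \<open>N > 0\<close> by (simp add: steiner_quasigroup_def)
  moreover have "y div N = y' div N"
    using e y edge_disjoint_cliquesD(2)[of x _ N q n] by metis
  ultimately have "y = y'" by (metis div_mult_mod_eq)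
  then show False using ne y by simp
qed

lemma no_rainbow_broom:
  assumes sq: "steiner_quasigroup (Suc t) m" and "t \<ge> 3"
    and copy: "copy_of_in (broom t 3) H (disjoint_cliques (Suc t) q n)"
  shows "\<not> rainbow (clique_coloring (Suc t) m) H"
proof
  let ?N = "Suc t" and ?G = "disjoint_cliques (Suc t) q n" and ?c = "clique_coloring (Suc t) m"
  assume "rainbow ?c H"
  then have inj_c: "inj_on ?c (edges H)" by (simp add: rainbow_def)
  obtain f where bij: "bij_betw f {0..t} (verts H)"
    and im: "(\<lambda>e. f ` e) ` edges (broom t 3) = edges H"
    using copy by (auto simp: copy_of_in_def isomorphic_def broom_def)
  have "edges H \<subseteq> edges ?G"
    using copy by (simp add: copy_of_in_def subgraph_def)
  have inj_f: "f i = f j \<longleftrightarrow> i = j" if "i \<le> t" "j \<le> t" for i j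
    using bij that by (auto simp: bij_betw_def inj_on_def)
  have broom_edge: "{f i, f j} \<in> edges H" if "{i, j} \<in> edges (broom t 3)" for i j
    using imageI[OF that, of "image f"] im by simp
  have path: "{i, i + 1} \<in> edges (broom t 3)" if "i < 3" for i
    using that by (auto simp: broom_def)
  have handle: "{0, 1} \<in> edges (broom t 3)" "{1, 2} \<in> edges (broom t 3)"
    using path[of 0] path[of 1] by (simp_all add: numeral_2_eq_2)
  have center: "{3, 2} \<in> edges (broom t 3)" "\<And>j. 3 < j \<Longrightarrow> j \<le> t \<Longrightarrow> {3, j} \<in> edges (broom t 3)"
    using path[of 2] by (simp_all add: insert_commute) (auto simp: broom_def)
  have H01: "{f 0, f 1} \<in> edges H" and H12: "{f 1, f 2} \<in> edges H" using broom_edge handle by auto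
  \<comment> \<open>The last handle edge and the bristles play the same role: together they join
    \<open>f 3\<close> to every vertex but \<open>f 0\<close> and \<open>f 1\<close>.\<close>
  have H3: "{f 3, f j} \<in> edges H" if "j \<le> t" "j \<notin> {0, 1, 3}" for j
    using broom_edge center that by (cases "j = 2") auto
  \<comment> \<open>The broom is connected, so its copy stays in one clique, where labels
    distinguish vertices.\<close>
  have same: "f j div ?N = f 3 div ?N" if "j \<le> t" for j
  proof -
    have *: "x div ?N = y div ?N" if "{x, y} \<in> edges H" for x y
      using that \<open>edges H \<subseteq> edges ?G\<close> edge_disjoint_cliquesD(2) by blast
    have "f 3 div ?N = f 2 div ?N" using *[OF H3[of 2]] \<open>t \<ge> 3\<close> by simp
    then show ?thesis
      using *[OF H01] *[OF H12] *[OF H3[of j]] that by (cases "j \<in> {0, 1, 3}") auto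
  qed
  define p where "p j = f j mod ?N" for j
  have p_eq: "p i = p j \<longleftrightarrow> i = j" if "i \<le> t" "j \<le> t" for i j
    using inj_f[OF that] same[OF that(1)] same[OF that(2)] unfolding p_def
    by (metis div_mult_mod_eq)
  have p_less: "p j < ?N" for j by (simp add: p_def)
  \<comment> \<open>The t + 1 distinct labels exhaust all residues: the copy spans its
    clique.\<close>
  have "p ` {..t} = {..<?N}"
    using p_eq p_less
    by (intro card_subset_eq) (auto simp: card_image inj_on_def)
  then have p_surj: "\<exists>j\<le>t. p j = w" if "w < ?N" for w
    using that by (metis atMost_iff image_iff lessThan_iff)
  have idem: "m x x = x" if "x < ?N" for x
    using sq that by (simp add: steiner_quasigroup_def)
  have closed: "m x y < ?N" and comm: "m x y = m y x" and cancel: "m x (m x y) = y"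
    if "x < ?N" "y < ?N" for x y
    using sq that by (simp_all add: steiner_quasigroup_def)
  have col: "?c {f i, f j} = m (p i) (p j)" for i j
    using clique_coloring_edge[OF sq] by (simp add: p_def)
  \<comment> \<open>All colors other than these three occur at the center \<open>f 3\<close> of the broom.\<close>
  have avail: "?c e \<in> {p 3, m (p 3) (p 0), m (p 3) (p 1)}" if e: "e \<in> edges H" "f 3 \<notin> e" for e
  proof -
    have "e \<in> edges ?G" using e \<open>edges H \<subseteq> edges ?G\<close> by blast
    then have "card e = 2" by (auto simp: disjoint_cliques_def)
    then obtain x y where "e = {x, y}" by (auto simp: card_2_iff)
    then have "?c e < ?N" using clique_coloring_edge[OF sq] closed by simp
    then have "m (p 3) (?c e) < ?N" using closed p_less by blast
    \<comment> \<open>\<open>f j\<close> is the vertex whose label gives color \<open>?c e\<close>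
      with \<open>p 3\<close>; by rainbowness \<open>{f 3, f j}\<close> is not in \<open>H\<close>.
      The case j = 3 is the color missing at \<open>f 3\<close>.\<close>
    then obtain j where j: "j \<le> t" "p j = m (p 3) (?c e)" using p_surj by blast
    then have ce: "?c e = m (p 3) (p j)" using cancel p_less \<open>?c e < ?N\<close> by simp
    have "j \<in> {0, 1, 3}"
    proof (rule ccontr)
      assume "j \<notin> {0, 1, 3}"
      then have "{f 3, f j} \<in> edges H" using H3 j by blast
      then have "e = {f 3, f j}" using inj_onD[OF inj_c _ e(1)] ce col by simp
      then show False using e(2) by simp
    qed
    then show ?thesis using ce idem p_less by auto
  qed
  have comm_p: "m (p i) (p j) = m (p j) (p i)" and cancel_p: "m (p i) (m (p i) (p j)) = p j" for i j
    using comm cancel p_less by blast+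
  have "p 3 \<noteq> p 0" "p 3 \<noteq> p 1"
    using p_eq[of 3 0] p_eq[of 3 1] \<open>t \<ge> 3\<close> by simp_all
  have "m (p 0) (p 1) \<in> {p 3, m (p 3) (p 0), m (p 3) (p 1)}"
    using avail[OF H01] col inj_f[of 3] \<open>t \<ge> 3\<close> by simp
  \<comment> \<open>Cancelling the shared \<open>p 0\<close> or \<open>p 1\<close> would identify
    \<open>p 3\<close> with \<open>p 1\<close> or \<open>p 0\<close>.\<close>
  moreover have "m (p 0) (p 1) \<noteq> m (p 3) (p 0)" "m (p 0) (p 1) \<noteq> m (p 3) (p 1)"
    using comm_p cancel_p \<open>p 3 \<noteq> p 0\<close> \<open>p 3 \<noteq> p 1\<close> by metis+
  ultimately have "m (p 0) (p 1) = p 3" by blast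
  \<comment> \<open>Now \<open>p 0\<close>, \<open>p 1\<close>, \<open>p 3\<close> form a Steiner
    triple, closed under \<open>m\<close>. Since \<open>p 1\<close> and the color of the second
    handle edge both lie in it, so does \<open>p 2\<close>, a contradiction.\<close>
  then have v: "m (p 3) (p 0) = p 1" "m (p 3) (p 1) = p 0"
    using comm_p cancel_p by metis+
  have "m (p 1) (p 2) \<in> {p 3, p 1, p 0}"
    using avail[OF H12] col inj_f[of 3] \<open>t \<ge> 3\<close> v by auto
  then have "p 2 \<in> {m (p 1) (p 3), m (p 1) (p 1), m (p 1) (p 0)}"
    using cancel_p[of 1 2] by auto
  then have "p 2 \<in> {p 0, p 1, p 3}"
    using v idem[OF p_less] comm_p[of 1 3] comm_p[of 1 0] \<open>m (p 0) (p 1) = p 3\<close> by auto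
  then show False using p_eq[of 2] \<open>t \<ge> 3\<close> by auto
qed

text \<open>Each vertex in a clique has degree t and contributes t/2 edges; fewer than t + 1
  vertices are left over, which accounts for the constant.\<close>

lemma rainbow_turan_broom_ge:
  assumes "steiner_quasigroup (Suc t) m" "t \<ge> 3"
  shows "real (rainbow_turan n (broom t 3)) \<ge> real t / 2 * real n - real t * (real t + 1) / 2"
proof -
  let ?q = "n div Suc t"
  let ?G = "disjoint_cliques (Suc t) ?q n"
  have "rainbow_free (broom t 3) ?G"
    using proper_clique_coloring[OF assms(1)] no_rainbow_broom[OF assms]
    unfolding rainbow_free_def by blast
  moreover have "finite_simple_graph ?G"
    by (intro finite_simple_graph_disjoint_cliques div_times_less_eq_dividend)
  moreover have "card (verts ?G) = n" by (simp add: disjoint_cliques_def)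
  ultimately have "card (edges ?G) \<le> rainbow_turan n (broom t 3)"
    unfolding rainbow_turan_def by (intro Max_ge rainbow_turan_finite) blast
  then have turan: "real ?q * real (Suc t choose 2) \<le> real (rainbow_turan n (broom t 3))"
    by (metis card_edges_disjoint_cliques of_nat_le_iff of_nat_mult)
  have "2 * (Suc t choose 2) = Suc t * t"
    using times_binomial_minus1_eq[of 2 "Suc t"] by simp
  then have choose: "real (Suc t choose 2) = real (Suc t) * real t / 2"
    by (metis of_nat_mult of_nat_numeral nonzero_mult_div_cancel_left zero_neq_numeral)
  have "n \<le> ?q * Suc t + Suc t"
    using div_mult_mod_eq[of n "Suc t"] mod_less_divisor[of "Suc t" n] by linarith
  then have "real n \<le> real ?q * real (Suc t) + real (Suc t)"
    by (metis of_nat_add of_nat_le_iff of_nat_mult)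
  then have "real t / 2 * real n \<le> real t / 2 * (real ?q * real (Suc t) + real (Suc t))"
    by (intro mult_left_mono) auto
  also have "\<dots> = real ?q * real (Suc t choose 2) + real t * (real t + 1) / 2"
    unfolding choose by (simp add: field_simps)
  finally show ?thesis using turan by linarith
qed

theorem theorem1p8:
  fixes s t :: nat
  assumes "s \<ge> 2" and "t = 3 ^ s - 1"
  shows "\<exists>g :: nat \<Rightarrow> real. g \<in> O(\<lambda>_. 1) \<and>
           (\<forall>n. real (rainbow_turan n (broom t 3)) \<ge> real t / 2 * real n + g n)"
proof -
  \<comment> \<open>From s \<ge> 2 comes t \<ge> 8, so the handle of length 3 fits.\<close>
  have "(3::nat) ^ 2 \<le> 3 ^ s" using assms(1) by (intro power_increasing) auto
  then have t: "Suc t = 3 ^ s" "t \<ge> 3" using assms(2) by auto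
  let ?g = "\<lambda>_::nat. - (real t * (real t + 1) / 2)"
  have "real (rainbow_turan n (broom t 3)) \<ge> real t / 2 * real n + ?g n" for n
    using rainbow_turan_broom_ge[of t "ternary_op s" n] steiner_quasigroup_ternary_op[of s] t by simp
  moreover have "?g \<in> O(\<lambda>_. 1)" by simp
  ultimately show ?thesis by blast
qed

end
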